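(* Let $d$ be a positive integer, and let $q\geq 2$ and $w\geq 0$ be real numbers. For every $d$-regular graph $G$ we have $$Z_G(q,w)\geq \Phi_{d,q,w}^{v(G)}.$$ Furthermore, for every fixed $\varepsilon>0$ and every fixed positive integer $g$, if a $d$-regular graph $G$ contains at least $\varepsilon v(G)$ cycles of length at most $g$, then $Z_G(q,w)$ is exponentially larger than this bound: there exists $\delta=\delta(d,q,w,\varepsilon,g)>0$ such that for every such $G$ $$Z_G(q,w)\geq \left((1+\delta)\Phi_{d,q,w}\right)^{v(G)}.$$
   Context: Graphs are finite; $v(G)$ is the number of vertices of $G$. For a graph $G=(V,E)$, $$Z_G(q,w)=\sum_{A\subseteq E(G)}q^{k(A)}w^{|A|},$$ where $k(A)$ is the number of connected components of the graph $(V,A)$. The quantity $\Phi_{d,q,w}$ is $\max_{t\in[-\pi,\pi]}\Phi_{d,q,w}(t)$, where $$\Phi_{d,q,w}(t)=\left(\sqrt{1+\frac{w}{q}}\cos(t)+\sqrt{\frac{(q-1)w}{q}}\sin(t)\right)^{d}+(q-1)\left(\sqrt{1+\frac{w}{q}}\cos(t)-\sqrt{\frac{w}{q(q-1)}}\sin(t)\right)^{d}.$$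
   Formalization: The "furthermore" part is stated for w > 0 only: at w = 0 one has Z_G(q,0) = q^{v(G)} and Φ_{d,q,0} = q, so equality holds and no δ > 0 exists (e.g. G = K_4, d = 3, g = 3, ε = 1). *)

theory Defs
  imports "HOL-Analysis.Analysis"
begin

section \<open>Finite simple graphs\<close>

text \<open>Vertices come from an arbitrary type \<open>'a\<close>. A statement of the form "there is a constant such
  that for every graph over \<open>'a\<close>" is uniform over all finite graphs already at
  \<open>'a = nat\<close>, where every finite graph has an isomorphic copy.\<close>

definition fin_graph :: "'a set \<Rightarrow> 'a set set \<Rightarrow> bool" where
  "fin_graph V E \<longleftrightarrow> finite V \<and> (\<forall>e\<in>E. e \<subseteq> V \<and> card e = 2)"

definition regular_graph :: "nat \<Rightarrow> 'a set \<Rightarrow> 'a set set \<Rightarrow> bool" where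
  "regular_graph d V E \<longleftrightarrow> fin_graph V E \<and> (\<forall>v\<in>V. card {e \<in> E. v \<in> e} = d)"

definition connected_rel :: "'a set \<Rightarrow> 'a set set \<Rightarrow> 'a rel" where
  "connected_rel V A = {(x, y). {x, y} \<in> A}\<^sup>* \<inter> V \<times> V"

definition num_components :: "'a set \<Rightarrow> 'a set set \<Rightarrow> nat" where
  "num_components V A = card (V // connected_rel V A)"

definition cycle_edges :: "'a list \<Rightarrow> 'a set set" where
  "cycle_edges p = {{p ! i, p ! (Suc i mod length p)} | i. i < length p}"

text \<open>A cycle is a subgraph, represented by its edge set, so rotations and reversals of the
  vertex list \<open>p\<close> are not counted separately.\<close>

definition short_cycles :: "nat \<Rightarrow> 'a set set \<Rightarrow> 'a set set set" where
  "short_cycles g E =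
     {cycle_edges p | p. distinct p \<and> 3 \<le> length p \<and> length p \<le> g \<and> cycle_edges p \<subseteq> E}"

section \<open>The random cluster partition function and its lower bound\<close>

definition cluster_Z :: "'a set \<Rightarrow> 'a set set \<Rightarrow> real \<Rightarrow> real \<Rightarrow> real" where
  "cluster_Z V E q w = (\<Sum>A\<in>Pow E. q ^ num_components V A * w ^ card A)"

definition Phi_at :: "nat \<Rightarrow> real \<Rightarrow> real \<Rightarrow> real \<Rightarrow> real" where
  "Phi_at d q w t =
     (sqrt (1 + w / q) * cos t + sqrt ((q - 1) * w / q) * sin t) ^ d
     + (q - 1) * (sqrt (1 + w / q) * cos t - sqrt (w / (q * (q - 1))) * sin t) ^ d"

definition Phi :: "nat \<Rightarrow> real \<Rightarrow> real \<Rightarrow> real" where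
  "Phi d q w = (SUP t\<in>{-pi..pi}. Phi_at d q w t)"

text \<open>The supremum is a maximum.\<close>

lemma Phi_attained:
  "\<exists>t\<in>{-pi..pi}. Phi d q w = Phi_at d q w t \<and> (\<forall>s\<in>{-pi..pi}. Phi_at d q w s \<le> Phi_at d q w t)"
proof -
  have "continuous_on {-pi..pi} (Phi_at d q w)"
    unfolding Phi_at_def by (intro continuous_intros)
  moreover have "{-pi..pi} \<noteq> {}"
    using pi_ge_zero by (simp del: pi_ge_zero)
  ultimately obtain t where t: "t \<in> {-pi..pi}" "\<forall>s\<in>{-pi..pi}. Phi_at d q w s \<le> Phi_at d q w t"
    using continuous_attains_sup[of "{-pi..pi}" "Phi_at d q w"] by auto
  then have "Phi d q w = Phi_at d q w t"
    unfolding Phi_def by (intro cSup_eq_maximum) auto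
  with t show ?thesis by blast
qed

text \<open>At \<open>w = 0\<close> both sides of the lower bound equal \<open>q ^ card V\<close> for every graph, with or
  without short cycles, so an exponential improvement is possible only for \<open>w > 0\<close>.\<close>

lemma cluster_Z_zero:
  assumes "fin_graph V E"
  shows "cluster_Z V E q 0 = q ^ card V"
proof -
  have "finite E"
    using assms finite_subset[of E "Pow V"] by (auto simp: fin_graph_def)
  then have fin: "finite (Pow E)" by simp
  have "cluster_Z V E q 0 = (\<Sum>A\<in>Pow E. if A = {} then q ^ num_components V {} else 0)"
    unfolding cluster_Z_def
    using \<open>finite E\<close> by (intro sum.cong) (auto simp: power_0_left dest: finite_subset)
  also have "\<dots> = q ^ num_components V {}"
    using fin by (simp add: sum.delta)
  also have "V // connected_rel V {} = (\<lambda>v. {v}) ` V"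
    by (auto simp: quotient_def connected_rel_def)
  then have "num_components V {} = card V"
    by (simp add: num_components_def card_image)
  finally show ?thesis .
qed

lemma Phi_zero:
  assumes "q \<ge> 1"
  shows "Phi d q 0 = q"
proof -
  have eq: "Phi_at d q 0 t = q * cos t ^ d" for t
    by (simp add: Phi_at_def algebra_simps)
  have "cos t ^ d \<le> 1" for t :: real
    by (metis abs_cos_le_one abs_ge_self abs_ge_zero order_trans power_abs power_le_one)
  then have "Phi_at d q 0 t \<le> q" for t
    using mult_left_mono[of "cos t ^ d" 1 q] assms by (simp add: eq)
  moreover have "q = Phi_at d q 0 0" by (simp add: eq)
  ultimately show ?thesis
    unfolding Phi_def by (intro cSup_eq_maximum) auto
qed

end

theory Submission
  imports Defs
begin

text \<open>Distributing the factor \<open>q = 1 + (q - 1)\<close> of each component and using that a graph with edge set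
  \<open>A\<close> on \<open>U\<close> has at least \<open>card U - card A\<close> components (here \<open>q - 1 \<ge> 1\<close> is needed) bounds
  \<open>Z\<close> from below by a two-spin model with vertex weights \<open>1, q - 1\<close> and symmetric interaction matrix
  \<open>M\<close>, where \<open>M\<^sub>1\<^sub>1 = 1 + w\<close>, \<open>M\<^sub>1\<^sub>2 = 1\<close>, \<open>M\<^sub>2\<^sub>2 = 1 + w / (q - 1)\<close>. Let \<open>a\<^sub>1, a\<^sub>2\<close> be the two linear
  forms in \<open>cos t, sin t\<close> in the definition of \<open>\<Phi>(t)\<close> and \<open>b\<^sub>1, b\<^sub>2\<close> their derivatives in \<open>t\<close>. Then
  \<open>M\<^sub>i\<^sub>j = a\<^sub>i a\<^sub>j + b\<^sub>i b\<^sub>j\<close> for every \<open>t\<close>, so the two-spin model equals the sum over \<open>A \<subseteq> E\<close> of the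
  products of \<open>s (deg\<^sub>A v)\<close> over the vertices, with \<open>s k = a\<^sub>1\<^sup>d\<^sup>-\<^sup>k b\<^sub>1\<^sup>k + (q - 1) a\<^sub>2\<^sup>d\<^sup>-\<^sup>k b\<^sub>2\<^sup>k\<close>.
  At a maximiser of \<open>\<Phi>(t)\<close> we have \<open>s 0 = \<Phi>\<close> and \<open>s 1 = 0\<close>, and, after a change of signs, this makes
  all \<open>s k\<close> nonnegative. The term \<open>A = {}\<close> gives the first bound. If \<open>w > 0\<close> then \<open>s 2 > 0\<close>, and the
  unions of subfamilies of a maximal family of vertex-disjoint short cycles, which is linear in size,
  give the exponential gain.\<close>

section \<open>A nonnegative decomposition at the maximiser\<close>

text \<open>By periodicity the maximum over the interval bounds \<open>Phi_at\<close> on the whole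
  line. Hence a maximiser is a local maximum even at an endpoint, and angles found by reflection
  need no range check.\<close>

lemma Phi_at_le_Phi: "Phi_at d q w t \<le> Phi d q w"
proof -
  obtain s where s: "- pi < s" "s \<le> pi" "sin s = sin t" "cos s = cos t"
    using sincos_principal_value by blast
  then have "Phi_at d q w t = Phi_at d q w s" by (simp add: Phi_at_def)
  then show ?thesis
    using Phi_attained[of d q w] s(1,2) by auto
qed

lemma Phi_pos:
  assumes "q \<ge> 2" "w \<ge> 0"
  shows "Phi d q w > 0"
proof -
  have "1 + w / q > 0"
    using assms by (simp add: add_pos_nonneg)
  then have "Phi_at d q w 0 > 0"
    using assms by (simp add: Phi_at_def add_pos_nonneg)
  then show ?thesis
    using Phi_at_le_Phi[of d q w 0] by linarith
qed

definition spin_coeff :: "nat \<Rightarrow> real \<Rightarrow> real \<Rightarrow> real \<Rightarrow> real \<Rightarrow> real \<Rightarrow> nat \<Rightarrow> real" where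
  "spin_coeff d q a1 a2 b1 b2 k = a1 ^ (d - k) * b1 ^ k + (q - 1) * (a2 ^ (d - k) * b2 ^ k)"

text \<open>Reflecting the unit vector \<open>(c, s)\<close> about the line through \<open>(\<alpha>, \<beta>)\<close> shows that the two linear
  forms cannot have opposite signs at a maximiser when \<open>d\<close> is even.\<close>

lemma reflection_increases:
  fixes \<alpha> \<beta> \<gamma> c s :: real
  assumes "c\<^sup>2 + s\<^sup>2 = 1" "\<alpha>\<^sup>2 - \<beta> * \<gamma> = 1"
    and neg: "(\<alpha> * c + \<beta> * s) * (\<alpha> * c - \<gamma> * s) < 0"
  shows "\<exists>t. \<alpha> * cos t + \<beta> * sin t = \<alpha> * c + \<beta> * s
           \<and> \<bar>\<alpha> * c - \<gamma> * s\<bar> < \<bar>\<alpha> * cos t - \<gamma> * sin t\<bar>"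
proof -
  define a where "a = \<alpha> * c + \<beta> * s"
  define b where "b = \<beta> * c - \<alpha> * s" \<comment> \<open>the reflection is \<open>(a, b) \<mapsto> (a, - b)\<close>\<close>
  define N where "N = \<alpha>\<^sup>2 + \<beta>\<^sup>2"
  have ab: "a\<^sup>2 + b\<^sup>2 = N"
  proof -
    have "a\<^sup>2 + b\<^sup>2 = N * (c\<^sup>2 + s\<^sup>2)"
      unfolding a_def b_def N_def by algebra
    then show ?thesis using assms(1) by simp
  qed
  have "N > 0"
  proof -
    have "a \<noteq> 0" using neg a_def by auto
    then show ?thesis using ab by (metis add_pos_nonneg zero_le_power2 zero_less_power2)
  qed
  \<comment> \<open>The pair \<open>(x, y)\<close> solves
    \<open>\<alpha> * x + \<beta> * y = a\<close> and
    \<open>\<beta> * x - \<alpha> * y = - b\<close>; it is again a unit vector, hence given by an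
    angle.\<close>
  define x where "x = (a * \<alpha> - b * \<beta>) / N"
  define y where "y = (a * \<beta> + b * \<alpha>) / N"
  have "(a * \<alpha> - b * \<beta>)\<^sup>2 + (a * \<beta> + b * \<alpha>)\<^sup>2 = (a\<^sup>2 + b\<^sup>2) * N"
    unfolding N_def by algebra
  then have "x\<^sup>2 + y\<^sup>2 = 1"
    using \<open>N > 0\<close> ab by (simp add: x_def y_def power_divide power2_eq_square flip: add_divide_distrib)
  then obtain t where t: "x = cos t" "y = sin t"
    using sincos_total_2pi by metis
  have "N * (\<alpha> * x + \<beta> * y) = \<alpha> * (a * \<alpha> - b * \<beta>) + \<beta> * (a * \<beta> + b * \<alpha>)"
    using \<open>N > 0\<close> by (simp add: x_def y_def field_simps)
  also have "\<dots> = N * a"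
    unfolding N_def by algebra
  finally have 1: "\<alpha> * x + \<beta> * y = a"
    using \<open>N > 0\<close> by simp
  \<comment> \<open>Times \<open>N\<close>, the second form is \<open>a + e\<close> before the
    reflection and \<open>a - e\<close> after it. The sign hypothesis says
    \<open>a * (a + e) < 0\<close>, which forces \<open>a * e < 0\<close> and so makes the second
    absolute value larger.\<close>
  define e where "e = b * (\<alpha> * (\<beta> + \<gamma>))"
  have "a * (\<alpha>\<^sup>2 - \<beta> * \<gamma>) + e = N * (\<alpha> * c - \<gamma> * s)"
    unfolding a_def b_def N_def e_def by algebra
  then have 2: "N * (\<alpha> * c - \<gamma> * s) = a + e" using assms(2) by simp
  have "N * (\<alpha> * x - \<gamma> * y) = \<alpha> * (a * \<alpha> - b * \<beta>) - \<gamma> * (a * \<beta> + b * \<alpha>)"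
    using \<open>N > 0\<close> by (simp add: x_def y_def field_simps)
  also have "\<dots> = a * (\<alpha>\<^sup>2 - \<beta> * \<gamma>) - e"
    unfolding e_def by algebra
  finally have 3: "N * (\<alpha> * x - \<gamma> * y) = a - e" using assms(2) by simp
  have "a * (N * (\<alpha> * c - \<gamma> * s)) < 0"
    using neg \<open>N > 0\<close> unfolding a_def[symmetric] by (simp add: mult.left_commute mult_pos_neg)
  then have "a * (a + e) < 0" using 2 by simp
  then have "a * e < 0"
    by (smt (verit) distrib_left zero_le_square)
  then have "(a + e)\<^sup>2 < (a - e)\<^sup>2"
    by (simp add: power2_eq_square algebra_simps)
  then have "\<bar>a + e\<bar> < \<bar>a - e\<bar>"
    by (metis abs_le_square_iff not_le)
  then have "\<bar>N * (\<alpha> * c - \<gamma> * s)\<bar> < \<bar>N * (\<alpha> * x - \<gamma> * y)\<bar>"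
    using 2 3 by simp
  then have "\<bar>\<alpha> * c - \<gamma> * s\<bar> < \<bar>\<alpha> * x - \<gamma> * y\<bar>"
    using \<open>N > 0\<close> by (simp add: abs_mult)
  with 1 t show ?thesis unfolding a_def by auto
qed

text \<open>Put \<open>r1 = b1 / a1\<close>, \<open>r2 = b2 / a2\<close> and
  \<open>X = a1 ^ (d - 1) * b1\<close>. Criticality makes the coefficient of index
  \<open>Suc j\<close> equal to \<open>X * (r1 ^ j - r2 ^ j)\<close>. The hypothesis
  \<open>sgn\<close> makes the ratio of larger absolute value nonnegative, and then both factors
  have the same sign.\<close>

lemma critical_coeffs_nonneg:
  assumes "a1 > 0" "a2 > 0" "q \<ge> 2" "d \<ge> 1" "k \<le> d"
    and crit: "a1 ^ (d - 1) * b1 + (q - 1) * (a2 ^ (d - 1) * b2) = 0"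
    and sgn: "(b1 \<ge> 0 \<and> \<bar>b2 / a2\<bar> \<le> \<bar>b1 / a1\<bar>) \<or> (b1 \<le> 0 \<and> \<bar>b1 / a1\<bar> \<le> \<bar>b2 / a2\<bar>)"
  shows "spin_coeff d q a1 a2 b1 b2 k \<ge> 0"
proof (cases k)
  case 0
  then show ?thesis using assms by (simp add: spin_coeff_def)
next
  case (Suc j)
  define r1 where "r1 = b1 / a1"
  define r2 where "r2 = b2 / a2"
  define X where "X = a1 ^ (d - 1) * b1"
  have pw: "a ^ (d - k) * (b::real) ^ k = a ^ (d - 1) * b * (b / a) ^ j" if "a > 0" for a b :: real
  proof -
    have "d - 1 = (d - k) + j" using Suc assms by simp
    then have "a ^ (d - 1) = a ^ (d - k) * a ^ j" by (simp add: power_add)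
    then show ?thesis using that Suc by (simp add: power_divide)
  qed
  have X: "(q - 1) * (a2 ^ (d - 1) * b2) = - X" using crit by (simp add: X_def)
  have "spin_coeff d q a1 a2 b1 b2 k = X * r1 ^ j + ((q - 1) * (a2 ^ (d - 1) * b2)) * r2 ^ j"
    unfolding spin_coeff_def pw[OF assms(1)] pw[OF assms(2)] by (simp add: X_def r1_def r2_def)
  then have eq: "spin_coeff d q a1 a2 b1 b2 k = X * (r1 ^ j - r2 ^ j)"
    unfolding X by (simp add: algebra_simps)
  have abs_pow: "x ^ j \<le> y ^ j" if "\<bar>x\<bar> \<le> \<bar>y\<bar>" "y \<ge> 0" for x y :: real
  proof -
    have "x ^ j \<le> \<bar>x\<bar> ^ j" by (metis abs_ge_self power_abs)
    also have "\<dots> \<le> y ^ j" using that by (simp add: power_mono)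
    finally show ?thesis .
  qed
  from sgn show ?thesis
  proof
    assume *: "b1 \<ge> 0 \<and> \<bar>b2 / a2\<bar> \<le> \<bar>b1 / a1\<bar>"
    then have "X \<ge> 0" "r1 \<ge> 0" using assms by (auto simp: X_def r1_def)
    then show ?thesis
      unfolding eq using * abs_pow[of r2 r1] by (auto simp: r1_def r2_def)
  next
    assume *: "b1 \<le> 0 \<and> \<bar>b1 / a1\<bar> \<le> \<bar>b2 / a2\<bar>"
    then have "X \<le> 0" using assms by (auto simp: X_def mult_nonneg_nonpos)
    then have "(q - 1) * (a2 ^ (d - 1) * b2) \<ge> 0" using crit by (simp add: X_def)
    moreover have "(q - 1) * a2 ^ (d - 1) > 0" using assms by simp
    ultimately have "b2 \<ge> 0" by (metis mult.assoc zero_le_mult_iff not_less_iff_gr_or_eq not_le)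
    then have "r2 \<ge> 0" using assms by (simp add: r2_def)
    then show ?thesis
      unfolding eq using * abs_pow[of r1 r2] \<open>X \<le> 0\<close>
      by (auto simp: r1_def r2_def mult_nonpos_nonpos)
  qed
qed

text \<open>Take the two linear forms at a maximiser \<open>t\<close> and their derivatives in
  \<open>t\<close>. The quadratic identities hold at every \<open>t\<close>, and the last equation
  is the vanishing derivative. The work lies in positivity: neither form vanishes, they agree in
  sign, and a common sign can be removed.\<close>

lemma critical_decomposition:
  assumes d: "d \<ge> 1" and q: "q \<ge> 2" and w: "w \<ge> 0"
  obtains a1 a2 b1 b2 where
    "a1 > 0" "a2 > 0"
    "a1\<^sup>2 + b1\<^sup>2 = 1 + w" "a1 * a2 + b1 * b2 = 1" "a2\<^sup>2 + b2\<^sup>2 = 1 + w / (q - 1)"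
    "a1 ^ d + (q - 1) * a2 ^ d = Phi d q w"
    "a1 ^ (d - 1) * b1 + (q - 1) * (a2 ^ (d - 1) * b2) = 0"
proof -
  define \<alpha> where "\<alpha> = sqrt (1 + w / q)"
  define \<beta> where "\<beta> = sqrt ((q - 1) * w / q)"
  define \<gamma> where "\<gamma> = sqrt (w / (q * (q - 1)))"
  have \<alpha>2: "\<alpha>\<^sup>2 = 1 + w / q" and \<beta>2: "\<beta>\<^sup>2 = (q - 1) * w / q" and \<gamma>2: "\<gamma>\<^sup>2 = w / (q * (q - 1))"
    using q w by (auto simp: \<alpha>_def \<beta>_def \<gamma>_def)
  have "\<beta> * \<gamma> = sqrt ((w / q)\<^sup>2)"
    using q by (simp add: \<beta>_def \<gamma>_def power2_eq_square flip: real_sqrt_mult)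
  then have \<beta>\<gamma>: "\<beta> * \<gamma> = w / q" using q w by simp
  have at: "Phi_at d q w t = (\<alpha> * cos t + \<beta> * sin t) ^ d + (q - 1) * (\<alpha> * cos t - \<gamma> * sin t) ^ d" for t
    by (simp add: Phi_at_def \<alpha>_def \<beta>_def \<gamma>_def)
  obtain t where t: "Phi d q w = Phi_at d q w t"
    using Phi_attained by blast
  define a1 where "a1 = \<alpha> * cos t + \<beta> * sin t"
  define a2 where "a2 = \<alpha> * cos t - \<gamma> * sin t"
  define b1 where "b1 = \<beta> * cos t - \<alpha> * sin t"
  define b2 where "b2 = - \<gamma> * cos t - \<alpha> * sin t"
  have s0: "a1 ^ d + (q - 1) * a2 ^ d = Phi d q w"
    using t at by (simp add: a1_def a2_def)
  have pos: "a1 ^ d + (q - 1) * a2 ^ d > 0" using Phi_pos[OF q w] s0 by simp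
  have cs: "(cos t)\<^sup>2 + (sin t)\<^sup>2 = 1" by simp
  have "a1\<^sup>2 + b1\<^sup>2 = (\<alpha>\<^sup>2 + \<beta>\<^sup>2) * ((cos t)\<^sup>2 + (sin t)\<^sup>2)"
    unfolding a1_def b1_def by algebra
  moreover have "\<alpha>\<^sup>2 + \<beta>\<^sup>2 = 1 + w"
    using q by (simp add: \<alpha>2 \<beta>2 field_simps)
  ultimately have m11: "a1\<^sup>2 + b1\<^sup>2 = 1 + w"
    by simp
  have "a2\<^sup>2 + b2\<^sup>2 = (\<alpha>\<^sup>2 + \<gamma>\<^sup>2) * ((cos t)\<^sup>2 + (sin t)\<^sup>2)"
    unfolding a2_def b2_def by algebra
  moreover have "\<alpha>\<^sup>2 + \<gamma>\<^sup>2 = 1 + w / (q - 1)"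
    using q by (simp add: \<alpha>2 \<gamma>2 divide_simps) (simp add: algebra_simps)
  ultimately have m22: "a2\<^sup>2 + b2\<^sup>2 = 1 + w / (q - 1)"
    by simp
  have "a1 * a2 + b1 * b2 = (\<alpha>\<^sup>2 - \<beta> * \<gamma>) * ((cos t)\<^sup>2 + (sin t)\<^sup>2)"
    unfolding a1_def a2_def b1_def b2_def by algebra
  then have m12: "a1 * a2 + b1 * b2 = 1"
    by (simp add: \<alpha>2 \<beta>\<gamma>)
  have s1: "a1 ^ (d - 1) * b1 + (q - 1) * (a2 ^ (d - 1) * b2) = 0"
  proof -
    have "(Phi_at d q w has_real_derivative
        real d * (a1 ^ (d - 1) * b1 + (q - 1) * (a2 ^ (d - 1) * b2))) (at t)"
      unfolding at[abs_def] a1_def a2_def b1_def b2_def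
      by (auto intro!: derivative_eq_intros simp: algebra_simps)
    then have "real d * (a1 ^ (d - 1) * b1 + (q - 1) * (a2 ^ (d - 1) * b2)) = 0"
      by (rule DERIV_local_max[of _ _ _ 1]) (auto simp: Phi_at_le_Phi t[symmetric])
    then show ?thesis using d by simp
  qed
  \<comment> \<open>If one form vanishes, then \<open>b1 * b2 = 1\<close>. For \<open>d > 1\<close>,
    criticality makes the other form vanish too, against positivity of \<open>Phi\<close>; for
    \<open>d = 1\<close> it reads \<open>b1 = - ((q - 1) * b2)\<close>, against
    \<open>b1 * b2 > 0\<close>.\<close>
  have ne: "a1 * a2 \<noteq> 0"
  proof
    assume 0: "a1 * a2 = 0"
    then have b: "b1 * b2 > 0" using m12 by linarith
    show False
    proof (cases "d = 1")
      case True
      then have "b1 = - ((q - 1) * b2)" using s1 by simp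
      then have "b1 * b2 = - ((q - 1) * b2\<^sup>2)" by (simp add: power2_eq_square)
      moreover have "(q - 1) * b2\<^sup>2 \<ge> 0" using q by simp
      ultimately show ?thesis using b by linarith
    next
      case False
      then obtain m where m: "d - 1 = Suc m" using d by (cases "d - 1") auto
      then have "a1 = 0 \<and> a2 = 0"
        using 0 s1 b q unfolding m by auto
      then show ?thesis using pos d by (simp add: power_0_left)
    qed
  qed
  have same_sign: "a1 * a2 > 0"
  proof (rule ccontr)
    assume "\<not> a1 * a2 > 0"
    then have neg: "a1 * a2 < 0" using ne by linarith
    show False
    \<comment> \<open>For even \<open>d\<close>, reflection keeps \<open>a1\<close> and enlarges the
      absolute value of the second form, beating the maximum. For odd \<open>d\<close> the factors
      \<open>a1 ^ (d - 1)\<close> and \<open>a2 ^ (d - 1)\<close> are positive while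
      \<open>b1\<close> and \<open>b2\<close> share a sign, so the derivative cannot vanish.\<close>
    proof (cases "even d")
      case True
      obtain t' where t': "\<alpha> * cos t' + \<beta> * sin t' = a1" "\<bar>a2\<bar> < \<bar>\<alpha> * cos t' - \<gamma> * sin t'\<bar>"
        using reflection_increases[OF cs, of \<alpha> \<beta> \<gamma>] neg \<alpha>2 \<beta>\<gamma> unfolding a1_def a2_def by auto
      have "a2 ^ d < (\<alpha> * cos t' - \<gamma> * sin t') ^ d"
        using power_strict_mono[OF t'(2), of d] True d by (simp add: power_even_abs)
      then have "Phi d q w < Phi_at d q w t'"
        unfolding at t'(1) s0[symmetric] using q by simp
      then show ?thesis using Phi_at_le_Phi[of d q w t'] by simp
    next
      case False
      then have ev: "even (d - 1)" by simp
      have p: "a1 ^ (d - 1) > 0" "(q - 1) * a2 ^ (d - 1) > 0"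
        using ne q ev by (auto simp: zero_less_power_eq)
      have "b1 * b2 > 0" using m12 neg by linarith
      then have "a1 ^ (d - 1) * (b1 * b2) + ((q - 1) * a2 ^ (d - 1)) * b2\<^sup>2 > 0"
        by (intro add_pos_nonneg mult_pos_pos[OF p(1)] mult_nonneg_nonneg[OF less_imp_le[OF p(2)]]) auto
      moreover have "(a1 ^ (d - 1) * b1 + (q - 1) * (a2 ^ (d - 1) * b2)) * b2 =
        a1 ^ (d - 1) * (b1 * b2) + ((q - 1) * a2 ^ (d - 1)) * b2\<^sup>2"
        by (simp add: algebra_simps power2_eq_square)
      ultimately show ?thesis unfolding s1 by simp
    qed
  qed
  show ?thesis
  proof (cases "a1 > 0")
    case True
    then have "a2 > 0" using same_sign by (simp add: zero_less_mult_iff)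
    then show ?thesis using that True m11 m12 m22 s0 s1 by blast
  next
    case False
    then have n: "- a1 > 0" "- a2 > 0" using same_sign by (auto simp: zero_less_mult_iff)
    \<comment> \<open>Two negative forms with a positive sum of \<open>d\<close>-th powers require
      even \<open>d\<close>. Negating all four numbers then preserves the \<open>d\<close>-th
      powers, the quadratic identities and, \<open>d - 1\<close> being odd, the critical
      equation.\<close>
    have "even d"
    proof (rule ccontr)
      assume "odd d"
      then have "a1 ^ d < 0" "a2 ^ d < 0" using n by (auto simp: power_less_zero_eq)
      then have "a1 ^ d + (q - 1) * a2 ^ d < 0" using q by (simp add: add_neg_neg mult_pos_neg)
      then show False using pos by simp
    qed
    then have "odd (d - 1)" using d by simp
    show ?thesis
      using that[of "- a1" "- a2" "- b1" "- b2"] n m11 m12 m22 s0 s1 \<open>even d\<close> \<open>odd (d - 1)\<close>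
      by simp
  qed
qed

lemma nonneg_decomposition:
  assumes d: "d \<ge> 1" and q: "q \<ge> 2" and w: "w \<ge> 0"
  obtains a1 a2 b1 b2 where
    "a1\<^sup>2 + b1\<^sup>2 = 1 + w" "a1 * a2 + b1 * b2 = 1" "a2\<^sup>2 + b2\<^sup>2 = 1 + w / (q - 1)"
    "spin_coeff d q a1 a2 b1 b2 0 = Phi d q w"
    "\<forall>k\<le>d. spin_coeff d q a1 a2 b1 b2 k \<ge> 0"
    "w > 0 \<longrightarrow> spin_coeff d q a1 a2 b1 b2 2 > 0"
proof -
  obtain a1 a2 b1 b2 where *:
    "a1 > 0" "a2 > 0"
    "a1\<^sup>2 + b1\<^sup>2 = 1 + w" "a1 * a2 + b1 * b2 = 1" "a2\<^sup>2 + b2\<^sup>2 = 1 + w / (q - 1)"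
    "a1 ^ d + (q - 1) * a2 ^ d = Phi d q w"
    "a1 ^ (d - 1) * b1 + (q - 1) * (a2 ^ (d - 1) * b2) = 0"
    using critical_decomposition[OF assms] by blast
  \<comment> \<open>For \<open>d = 1\<close> the exponent \<open>d - 2\<close> truncates to 0.
    Positivity still holds, and this is harmless later because a 1-regular graph contains no
    cycle.\<close>
  have s2: "spin_coeff d q a1 a2 (\<sigma> * b1) (\<sigma> * b2) 2 > 0" if "w > 0" "\<sigma>\<^sup>2 = 1" for \<sigma>
  proof -
    \<comment> \<open>With both derivatives zero the interaction matrix would have rank one, but for
      \<open>w > 0\<close> its determinant \<open>(1 + w) * (1 + w / (q - 1)) - 1\<close> is
      positive.\<close>
    have "b1 \<noteq> 0 \<or> b2 \<noteq> 0"
    proof (rule ccontr)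
      assume "\<not> (b1 \<noteq> 0 \<or> b2 \<noteq> 0)"
      then have b: "b1 = 0" "b2 = 0" by auto
      then have "(1 + w) * (1 + w / (q - 1)) = (a1 * a2)\<^sup>2"
        unfolding power_mult_distrib using * b by simp
      also have "a1 * a2 = 1" using *(4) b by simp
      finally have "(1 + w) * (1 + w / (q - 1)) = 1" by simp
      moreover have "(1 + w) * (1 + w / (q - 1)) > 1 * 1"
        using that q by (intro mult_strict_mono) auto
      ultimately show False by simp
    qed
    moreover have "a1 ^ (d - 2) > 0" "(q - 1) * a2 ^ (d - 2) > 0" using * q by auto
    ultimately show ?thesis
      using that unfolding spin_coeff_def power_mult_distrib
      by (smt (verit) mult.assoc mult_1 mult_nonneg_nonneg mult_pos_pos zero_le_power2 zero_less_power2)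
  qed
  \<comment> \<open>Negating both \<open>b1\<close> and \<open>b2\<close> only changes the sign of the odd coefficients, which all share one sign.\<close>
  define \<sigma> :: real where "\<sigma> = (if (b1 \<ge> 0) = (\<bar>b2 / a2\<bar> \<le> \<bar>b1 / a1\<bar>) then 1 else - 1)"
  have \<sigma>: "\<sigma> * \<sigma> = 1" "\<sigma>\<^sup>2 = 1" "\<bar>\<sigma>\<bar> = 1" by (auto simp: \<sigma>_def)
  have crit: "a1 ^ (d - 1) * (\<sigma> * b1) + (q - 1) * (a2 ^ (d - 1) * (\<sigma> * b2)) = 0"
  proof -
    have "a1 ^ (d - 1) * (\<sigma> * b1) + (q - 1) * (a2 ^ (d - 1) * (\<sigma> * b2))
       = \<sigma> * (a1 ^ (d - 1) * b1 + (q - 1) * (a2 ^ (d - 1) * b2))"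
      by (simp add: algebra_simps)
    then show ?thesis using * by simp
  qed
  have sgn: "(\<sigma> * b1 \<ge> 0 \<and> \<bar>\<sigma> * b2 / a2\<bar> \<le> \<bar>\<sigma> * b1 / a1\<bar>)
    \<or> (\<sigma> * b1 \<le> 0 \<and> \<bar>\<sigma> * b1 / a1\<bar> \<le> \<bar>\<sigma> * b2 / a2\<bar>)"
    by (cases "b1 \<ge> 0"; cases "\<bar>b2 / a2\<bar> \<le> \<bar>b1 / a1\<bar>") (simp_all add: \<sigma>_def)
  have "spin_coeff d q a1 a2 (\<sigma> * b1) (\<sigma> * b2) k \<ge> 0" if "k \<le> d" for k
    by (rule critical_coeffs_nonneg[OF *(1,2) q d that crit sgn])
  moreover have "a1 * a2 + \<sigma> * b1 * (\<sigma> * b2) = 1"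
    using *(4) by (simp add: \<sigma>_def)
  moreover have "a1\<^sup>2 + (\<sigma> * b1)\<^sup>2 = 1 + w" "a2\<^sup>2 + (\<sigma> * b2)\<^sup>2 = 1 + w / (q - 1)"
    using *(3,5) by (simp_all add: power_mult_distrib \<sigma>(2))
  moreover have "spin_coeff d q a1 a2 (\<sigma> * b1) (\<sigma> * b2) 0 = Phi d q w"
    using *(6) by (simp add: spin_coeff_def)
  ultimately show ?thesis
    using that s2[OF _ \<sigma>(2)] by blast
qed

section \<open>Reduction to a two-spin model\<close>

lemma sum_Pow_power_card:
  fixes c :: "'b :: comm_ring_1"
  assumes "finite S"
  shows "(\<Sum>T\<in>Pow S. c ^ card T) = (1 + c) ^ card S"
  using prod_add[OF assms, of "\<lambda>_. c" "\<lambda>_. 1"] by (simp add: add.commute)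

section \<open>Connected components under adding edges and restricting to unions of
  components\<close>

lemma equiv_connected_rel: "equiv V (connected_rel V A)"
proof (rule equivI)
  show "refl_on V (connected_rel V A)"
    by (auto simp: refl_on_def connected_rel_def)
  have "sym {(x, y). {x, y} \<in> A}"
    by (auto simp: sym_def insert_commute)
  then have "sym ({(x, y). {x, y} \<in> A}\<^sup>*)" by (rule sym_rtrancl)
  then show "sym (connected_rel V A)"
    by (auto simp: sym_def connected_rel_def)
  show "trans (connected_rel V A)"
    by (auto simp: trans_def connected_rel_def)
  show "connected_rel V A \<subseteq> V \<times> V"
    by (auto simp: connected_rel_def)
qed

lemma finite_components: "finite V \<Longrightarrow> finite (V // connected_rel V A)"
  by (simp add: finite_quotient equiv_type[OF equiv_connected_rel])

text \<open>A path from \<open>z\<close> could use the new edge only after reaching \<open>x\<close>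
  or \<open>y\<close> inside \<open>A\<close>.\<close>

lemma class_insert_edge:
  assumes z: "z \<in> V"
    and nx: "(z, x) \<notin> connected_rel V A" and ny: "(z, y) \<notin> connected_rel V A"
    and V: "x \<in> V" "y \<in> V"
  shows "connected_rel V (insert {x, y} A) `` {z} = connected_rel V A `` {z}"
proof -
  have "(z, u) \<in> {(u, v). {u, v} \<in> A}\<^sup>*"
    if "(z, u) \<in> {(u, v). {u, v} \<in> insert {x, y} A}\<^sup>*" for u
    using that
  proof induction
    case (step u v)
    then have "{u, v} \<in> A"
      using nx ny z V by (auto simp: connected_rel_def doubleton_eq_iff)
    then show ?case using step.IH by (auto intro: rtrancl_into_rtrancl)
  qed auto
  moreover have "{(u, v). {u, v} \<in> A}\<^sup>* \<subseteq> {(u, v). {u, v} \<in> insert {x, y} A}\<^sup>*"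
    by (rule rtrancl_mono) auto
  ultimately show ?thesis by (auto simp: connected_rel_def)
qed

text \<open>All classes other than those of \<open>x\<close> and \<open>y\<close> survive, and the
  new class of \<open>x\<close> is one more. So at most one class is lost.\<close>

lemma num_components_insert:
  assumes V: "finite V" and xy: "x \<in> V" "y \<in> V"
  shows "num_components V A \<le> Suc (num_components V (insert {x, y} A))"
proof -
  let ?R = "connected_rel V A" and ?R' = "connected_rel V (insert {x, y} A)"
  let ?D = "V // ?R - {?R `` {x}, ?R `` {y}}"
  note eq = equiv_connected_rel[of V A]
  have sub: "?D \<subseteq> V // ?R'"
  proof
    fix C assume C: "C \<in> ?D"
    then obtain z where z: "z \<in> V" "C = ?R `` {z}" by (auto simp: quotient_def)
    then have "(z, x) \<notin> ?R" "(z, y) \<notin> ?R"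
      using C equiv_class_eq[OF eq] by auto
    then have "C = ?R' `` {z}"
      using class_insert_edge[OF z(1) _ _ xy] z by simp
    then show "C \<in> V // ?R'" using z by (auto simp: quotient_def)
  qed
  have new: "?R' `` {x} \<in> V // ?R' - ?D"
  proof -
    have "x \<in> ?R' `` {x}" using xy by (auto simp: connected_rel_def)
    moreover have "x \<notin> C" if "C \<in> ?D" for C
      using that by (auto simp: quotient_def dest: equiv_class_eq[OF eq])
    ultimately show ?thesis using xy by (auto simp: quotient_def)
  qed
  have "card (V // ?R) \<le> card (?D \<union> {?R `` {x}, ?R `` {y}})"
    using V by (intro card_mono) (auto simp: finite_components)
  also have "\<dots> \<le> card ?D + 2"
    by (rule order_trans[OF card_Un_le]) (simp add: card_insert_if)
  finally have "card (V // ?R) \<le> card ?D + 2" .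
  moreover have "card ?D + 1 \<le> card (V // ?R')"
  proof -
    have "card (insert (?R' `` {x}) ?D) \<le> card (V // ?R')"
      using V sub new by (intro card_mono) (auto simp: finite_components)
    then show ?thesis using new V by (simp add: finite_components)
  qed
  ultimately show ?thesis by (simp add: num_components_def)
qed

lemma card_le_num_components_add_card:
  assumes V: "finite V" and "finite A" and "\<forall>e\<in>A. e \<subseteq> V \<and> card e = 2"
  shows "card V \<le> num_components V A + card A"
  using assms(2,3)
proof (induction A rule: finite_induct)
  case empty
  have "V // connected_rel V {} = (\<lambda>v. {v}) ` V"
    by (auto simp: quotient_def connected_rel_def)
  then show ?case by (simp add: num_components_def card_image)
next
  case (insert e A)
  then obtain x y where "e = {x, y}" by (auto simp: card_2_iff)
  with insert show ?case
    using num_components_insert[OF V, of x y A] by auto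
qed

text \<open>For \<open>U \<subseteq> V\<close> and edges inside \<open>V\<close>, these are exactly
  the unions of components of the graph \<open>(V, A)\<close>.\<close>

definition edge_closed :: "'a set set \<Rightarrow> 'a set \<Rightarrow> bool" where
  "edge_closed A U \<longleftrightarrow> (\<forall>e\<in>A. e \<subseteq> U \<or> e \<inter> U = {})"

text \<open>A walk along \<open>A\<close> that starts in \<open>U\<close> never leaves
  \<open>U\<close>, so the components inside \<open>U\<close> are components of the whole
  graph.\<close>

lemma class_edge_closed:
  assumes "edge_closed A U" "U \<subseteq> V" "z \<in> U"
  shows "connected_rel U {e \<in> A. e \<subseteq> U} `` {z} = connected_rel V A `` {z}"
proof -
  have "u \<in> U \<and> (z, u) \<in> {(x, y). {x, y} \<in> {e \<in> A. e \<subseteq> U}}\<^sup>*"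
    if "(z, u) \<in> {(x, y). {x, y} \<in> A}\<^sup>*" for u
    using that
  proof induction
    case base
    then show ?case using assms by auto
  next
    case (step u v)
    then have "{u, v} \<in> {e \<in> A. e \<subseteq> U}"
      using assms(1) by (auto simp: edge_closed_def)
    then show ?case using step.IH by (auto intro: rtrancl_into_rtrancl)
  qed
  moreover have "{(x, y). {x, y} \<in> {e \<in> A. e \<subseteq> U}}\<^sup>* \<subseteq> {(x, y). {x, y} \<in> A}\<^sup>*"
    by (rule rtrancl_mono) auto
  ultimately show ?thesis
    using assms(2,3) by (auto simp: connected_rel_def)
qed

text \<open>The right side is the sum of \<open>c ^ card T\<close> over all sets \<open>T\<close> of
  components. Sending \<open>U\<close> to its set of components is injective, with union as inverse.
  Since \<open>c \<ge> 1\<close>, the bound \<open>card_le_num_components_add_card\<close> inside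
  \<open>U\<close> compares the terms.\<close>

lemma sum_edge_closed_le:
  fixes c :: real
  assumes V: "finite V" and A: "finite A" "\<forall>e\<in>A. e \<subseteq> V \<and> card e = 2" and c: "c \<ge> 1"
  shows "(\<Sum>U | U \<subseteq> V \<and> edge_closed A U. c ^ card U / c ^ card {e \<in> A. e \<subseteq> U})
    \<le> (1 + c) ^ num_components V A"
proof -
  define h where "h U = U // connected_rel U {e \<in> A. e \<subseteq> U}" for U
  let ?I = "{U. U \<subseteq> V \<and> edge_closed A U}"
  have "(\<Sum>U\<in>?I. c ^ card U / c ^ card {e \<in> A. e \<subseteq> U}) \<le> (\<Sum>U\<in>?I. c ^ card (h U))"
  proof (rule sum_mono)
    fix U assume "U \<in> ?I"
    then have "finite U" using finite_subset[OF _ V] by simp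
    then have "card U \<le> card (h U) + card {e \<in> A. e \<subseteq> U}"
      unfolding h_def num_components_def[symmetric]
      by (rule card_le_num_components_add_card) (use A in simp_all)
    from power_increasing[OF this c]
    have "c ^ card U \<le> c ^ card (h U) * c ^ card {e \<in> A. e \<subseteq> U}"
      by (simp only: power_add)
    then show "c ^ card U / c ^ card {e \<in> A. e \<subseteq> U} \<le> c ^ card (h U)"
      using c by (simp add: divide_le_eq)
  qed
  also have "\<dots> = (\<Sum>T\<in>h ` ?I. c ^ card T)"
  proof -
    have "\<Union> (h U) = U" for U
      unfolding h_def by (rule Union_quotient[OF equiv_connected_rel])
    then have "inj_on h ?I" by (metis inj_onI)
    then show ?thesis by (simp add: sum.reindex)
  qed
  also have "\<dots> \<le> (\<Sum>T\<in>Pow (V // connected_rel V A). c ^ card T)"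
  proof (rule sum_mono2)
    show "h ` ?I \<subseteq> Pow (V // connected_rel V A)"
    proof clarify
      fix U C assume U: "U \<subseteq> V" "edge_closed A U" and "C \<in> h U"
      then obtain z where "z \<in> U" "C = connected_rel U {e \<in> A. e \<subseteq> U} `` {z}"
        by (auto simp: h_def elim: quotientE)
      with U show "C \<in> V // connected_rel V A"
        by (auto simp: class_edge_closed[OF U(2,1)] intro: quotientI)
    qed
  qed (use V c in \<open>simp_all add: finite_components\<close>)
  also have "\<dots> = (1 + c) ^ num_components V A"
    unfolding num_components_def using V by (intro sum_Pow_power_card) (simp add: finite_components)
  finally show ?thesis .
qed

lemma fin_graph_finite_edges: "fin_graph V E \<Longrightarrow> finite E"
  by (rule finite_subset[of E "Pow V"]) (auto simp: fin_graph_def)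

text \<open>Vertices in \<open>U\<close> carry the second spin, of weight \<open>q - 1\<close>, and
  each edge factor is the matrix entry for the spins of its ends. After expanding over
  \<open>A \<subseteq> E\<close>, an edge of \<open>A\<close> with ends of different spin
  contributes 0, so only edge-closed \<open>U\<close> survive. Then
  \<open>sum_edge_closed_le\<close> applies with \<open>c = q - 1\<close>.\<close>

lemma cluster_Z_ge_two_spin:
  assumes G: "fin_graph V E" and q: "q \<ge> 2" and w: "w \<ge> 0"
  shows "cluster_Z V E q w \<ge> (\<Sum>U\<in>Pow V. (q - 1) ^ card U *
    (\<Prod>e\<in>E. 1 + w * (if e \<subseteq> U then 1 / (q - 1) else if e \<inter> U = {} then 1 else 0)))"
proof -
  have V: "finite V" and E: "finite E" and e2: "\<forall>e\<in>E. e \<subseteq> V \<and> card e = 2"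
    using G fin_graph_finite_edges[OF G] by (auto simp: fin_graph_def)
  let ?c = "\<lambda>U e. w * (if e \<subseteq> U then 1 / (q - 1) else if e \<inter> U = {} then 1 else 0 :: real)"
  have ne: "\<not> (e \<subseteq> U \<and> e \<inter> U = {})" if "e \<in> E" for e U
  proof
    assume "e \<subseteq> U \<and> e \<inter> U = {}"
    then have "e = {}" by blast
    then show False using e2 that by fastforce
  qed
  have P: "(\<Prod>e\<in>A. ?c U e) =
      (if edge_closed A U then w ^ card A / (q - 1) ^ card {e \<in> A. e \<subseteq> U} else 0)"
    if A: "A \<subseteq> E" for A U
  proof (cases "edge_closed A U")
    case True
    have "finite A" using A E finite_subset by blast
    have "(\<Prod>e\<in>A. ?c U e) = (\<Prod>e\<in>A. w * (if e \<subseteq> U then 1 / (q - 1) else 1))"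
      using True by (intro prod.cong) (auto simp: edge_closed_def)
    also have "\<dots> = w ^ card A * (\<Prod>e\<in>{e \<in> A. e \<subseteq> U}. 1 / (q - 1))"
      unfolding prod.distrib prod.inter_filter[OF \<open>finite A\<close>] by simp
    finally show ?thesis using True by (simp add: power_divide)
  next
    case False
    then obtain e where "e \<in> A" "\<not> e \<subseteq> U" "e \<inter> U \<noteq> {}" by (auto simp: edge_closed_def)
    then have "(\<Prod>e\<in>A. ?c U e) = 0"
      using finite_subset[OF A E] by (intro prod_zero) (auto intro!: bexI[of _ e])
    then show ?thesis using False by simp
  qed
  have "(\<Sum>U\<in>Pow V. (q - 1) ^ card U * (\<Prod>e\<in>E. 1 + ?c U e)) =
    (\<Sum>U\<in>Pow V. (q - 1) ^ card U * (\<Sum>A\<in>Pow E. \<Prod>e\<in>A. ?c U e))"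
    using prod_add[OF E, of "?c _" "\<lambda>_. 1"] by (simp add: add.commute)
  also have "\<dots> = (\<Sum>A\<in>Pow E. \<Sum>U\<in>Pow V. (q - 1) ^ card U * (\<Prod>e\<in>A. ?c U e))"
    unfolding sum_distrib_left by (rule sum.swap)
  also have "\<dots> = (\<Sum>A\<in>Pow E. \<Sum>U | U \<subseteq> V \<and> edge_closed A U.
      w ^ card A * ((q - 1) ^ card U / (q - 1) ^ card {e \<in> A. e \<subseteq> U}))"
  proof (rule sum.cong[OF refl])
    fix A assume "A \<in> Pow E"
    then show "(\<Sum>U\<in>Pow V. (q - 1) ^ card U * (\<Prod>e\<in>A. ?c U e)) =
      (\<Sum>U | U \<subseteq> V \<and> edge_closed A U.
        w ^ card A * ((q - 1) ^ card U / (q - 1) ^ card {e \<in> A. e \<subseteq> U}))"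
      using V by (intro sum.mono_neutral_cong_right) (auto simp: P)
  qed
  also have "\<dots> \<le> (\<Sum>A\<in>Pow E. w ^ card A * q ^ num_components V A)"
  proof (rule sum_mono)
    fix A assume A: "A \<in> Pow E"
    then have "finite A" "\<forall>e\<in>A. e \<subseteq> V \<and> card e = 2" using E e2 by (auto intro: finite_subset)
    from mult_left_mono[OF sum_edge_closed_le[OF V this, of "q - 1"], of "w ^ card A"] q w
    show "(\<Sum>U | U \<subseteq> V \<and> edge_closed A U.
        w ^ card A * ((q - 1) ^ card U / (q - 1) ^ card {e \<in> A. e \<subseteq> U}))
      \<le> w ^ card A * q ^ num_components V A"
      by (simp add: sum_distrib_left)
  qed
  finally show ?thesis by (simp add: cluster_Z_def mult.commute)
qed

section \<open>Change of basis: the two-spin model as a sum over edge subsets\<close>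

definition edge_degree :: "'a set set \<Rightarrow> 'a \<Rightarrow> nat" where
  "edge_degree A v = card {e \<in> A. v \<in> e}"

lemma prod_edges_vertices:
  fixes f :: "'a \<Rightarrow> 'b :: comm_monoid_mult"
  assumes "finite V" "finite A" "\<forall>e\<in>A. e \<subseteq> V"
  shows "(\<Prod>e\<in>A. \<Prod>v\<in>e. f v) = (\<Prod>v\<in>V. f v ^ edge_degree A v)"
proof -
  have "(\<Prod>e\<in>A. \<Prod>v\<in>e. f v) = (\<Prod>e\<in>A. \<Prod>v | v \<in> V \<and> v \<in> e. f v)"
    using assms by (intro prod.cong) auto
  also have "\<dots> = (\<Prod>v\<in>V. \<Prod>e | e \<in> A \<and> v \<in> e. f v)"
    using assms by (intro prod.swap_restrict) auto
  finally show ?thesis by (simp add: edge_degree_def)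
qed

text \<open>Each edge factor splits into a product of \<open>a\<close> values plus a product of
  \<open>b\<close> values at its ends. Let \<open>A\<close> be the set of edges where the
  \<open>b\<close> term is chosen: by regularity a vertex of degree \<open>k\<close> in
  \<open>A\<close> receives \<open>k\<close> factors \<open>b\<close> and \<open>d - k\<close>
  factors \<open>a\<close>. The sum over the spins then factorises over the vertices.\<close>

lemma cluster_Z_ge_sum_spin_coeff:
  assumes G: "regular_graph d V E" and q: "q \<ge> 2" and w: "w \<ge> 0"
    and m: "a1\<^sup>2 + b1\<^sup>2 = 1 + w" "a1 * a2 + b1 * b2 = 1" "a2\<^sup>2 + b2\<^sup>2 = 1 + w / (q - 1)"
  shows "cluster_Z V E q w \<ge>
    (\<Sum>A\<in>Pow E. \<Prod>v\<in>V. spin_coeff d q a1 a2 b1 b2 (edge_degree A v))"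
proof -
  have fG: "fin_graph V E" and deg: "\<And>v. v \<in> V \<Longrightarrow> card {e \<in> E. v \<in> e} = d"
    using G by (auto simp: regular_graph_def)
  have V: "finite V" and E: "finite E" and e2: "\<forall>e\<in>E. e \<subseteq> V \<and> card e = 2"
    using fG fin_graph_finite_edges[OF fG] by (auto simp: fin_graph_def)
  define a where "a U v = (if v \<in> U then a2 else a1)" for U and v :: 'a
  define b where "b U v = (if v \<in> U then b2 else b1)" for U and v :: 'a
  have edge: "1 + w * (if e \<subseteq> U then 1 / (q - 1) else if e \<inter> U = {} then 1 else 0) =
      (\<Prod>v\<in>e. b U v) + (\<Prod>v\<in>e. a U v)" if "e \<in> E" for e U
  proof -
    obtain x y where "e = {x, y}" "x \<noteq> y" using e2 \<open>e \<in> E\<close> by (auto simp: card_2_iff)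
    then show ?thesis
      using m by (auto simp: a_def b_def power2_eq_square algebra_simps)
  qed
  have "(\<Sum>U\<in>Pow V. (q - 1) ^ card U *
    (\<Prod>e\<in>E. 1 + w * (if e \<subseteq> U then 1 / (q - 1) else if e \<inter> U = {} then 1 else 0))) =
    (\<Sum>U\<in>Pow V. (q - 1) ^ card U *
      (\<Sum>A\<in>Pow E. (\<Prod>e\<in>A. \<Prod>v\<in>e. b U v) * (\<Prod>e\<in>E - A. \<Prod>v\<in>e. a U v)))"
    by (simp add: edge prod_add[OF E])
  also have "\<dots> = (\<Sum>A\<in>Pow E. \<Sum>U\<in>Pow V. (q - 1) ^ card U *
      ((\<Prod>e\<in>A. \<Prod>v\<in>e. b U v) * (\<Prod>e\<in>E - A. \<Prod>v\<in>e. a U v)))"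
    unfolding sum_distrib_left by (rule sum.swap)
  also have "\<dots> = (\<Sum>A\<in>Pow E. \<Prod>v\<in>V. spin_coeff d q a1 a2 b1 b2 (edge_degree A v))"
  proof (rule sum.cong[OF refl])
    fix A assume "A \<in> Pow E"
    then have A: "A \<subseteq> E" "finite A" using E finite_subset by auto
    define k where "k = edge_degree A"
    have k: "edge_degree (E - A) v = d - k v" if "v \<in> V" for v
    proof -
      have "{e \<in> E - A. v \<in> e} = {e \<in> E. v \<in> e} - {e \<in> A. v \<in> e}" by auto
      then show ?thesis
        unfolding k_def edge_degree_def deg[OF that, symmetric]
        using A E by (simp add: card_Diff_subset Collect_mono subset_iff)
    qed
    have "(q - 1) ^ card U * ((\<Prod>e\<in>A. \<Prod>v\<in>e. b U v) * (\<Prod>e\<in>E - A. \<Prod>v\<in>e. a U v)) =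
      (\<Prod>v\<in>U. (q - 1) * (a2 ^ (d - k v) * b2 ^ k v)) * (\<Prod>v\<in>V - U. a1 ^ (d - k v) * b1 ^ k v)"
      if U: "U \<subseteq> V" for U
    proof -
      have "(\<Prod>e\<in>A. \<Prod>v\<in>e. b U v) * (\<Prod>e\<in>E - A. \<Prod>v\<in>e. a U v) =
        (\<Prod>v\<in>V. b U v ^ k v) * (\<Prod>v\<in>V. a U v ^ edge_degree (E - A) v)"
        unfolding k_def using V E A e2 by (subst (1 2) prod_edges_vertices[of V]) auto
      also have "\<dots> = (\<Prod>v\<in>V. a U v ^ (d - k v) * b U v ^ k v)"
        by (simp add: k prod.distrib mult.commute)
      also have "\<dots> = (\<Prod>v\<in>V - U. a U v ^ (d - k v) * b U v ^ k v) * (\<Prod>v\<in>U. a U v ^ (d - k v) * b U v ^ k v)"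
        by (rule prod.subset_diff[OF U V])
      also have "\<dots> = (\<Prod>v\<in>V - U. a1 ^ (d - k v) * b1 ^ k v) * (\<Prod>v\<in>U. a2 ^ (d - k v) * b2 ^ k v)"
        by (simp add: a_def b_def)
      finally show ?thesis
        by (simp add: prod.distrib)
    qed
    then have "(\<Sum>U\<in>Pow V. (q - 1) ^ card U *
      ((\<Prod>e\<in>A. \<Prod>v\<in>e. b U v) * (\<Prod>e\<in>E - A. \<Prod>v\<in>e. a U v))) =
      (\<Sum>U\<in>Pow V. (\<Prod>v\<in>U. (q - 1) * (a2 ^ (d - k v) * b2 ^ k v)) *
        (\<Prod>v\<in>V - U. a1 ^ (d - k v) * b1 ^ k v))"
      by (intro sum.cong) auto
    also have "\<dots> = (\<Prod>v\<in>V. spin_coeff d q a1 a2 b1 b2 (k v))"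
      unfolding spin_coeff_def prod_add[OF V, symmetric] by (simp add: add.commute)
    finally show "(\<Sum>U\<in>Pow V. (q - 1) ^ card U *
      ((\<Prod>e\<in>A. \<Prod>v\<in>e. b U v) * (\<Prod>e\<in>E - A. \<Prod>v\<in>e. a U v))) =
      (\<Prod>v\<in>V. spin_coeff d q a1 a2 b1 b2 (edge_degree A v))"
      by (simp add: k_def)
  qed
  finally show ?thesis
    using cluster_Z_ge_two_spin[OF fG q w] by simp
qed

section \<open>Disjoint short cycles\<close>

lemma Union_cycle_edges:
  assumes "p \<noteq> []"
  shows "\<Union> (cycle_edges p) = set p"
proof -
  have "p ! i \<in> \<Union> (cycle_edges p)" if "i < length p" for i
    using that by (auto simp: cycle_edges_def)
  moreover have "Suc i mod length p < length p" for i
    using assms by simp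
  ultimately show ?thesis
    by (fastforce simp: cycle_edges_def in_set_conv_nth)
qed

text \<open>The edges at \<open>p ! j\<close> are those indexed by \<open>j\<close> and by its
  cyclic predecessor \<open>j'\<close>. Length at least 3 keeps them distinct, as the successor of
  \<open>p ! j\<close> is not on the edge of index \<open>j'\<close>.\<close>

lemma edge_degree_cycle_edges:
  assumes p: "distinct p" "3 \<le> length p" and v: "v \<in> set p"
  shows "edge_degree (cycle_edges p) v = 2"
proof -
  define n where "n = length p"
  define f where "f i = {p ! i, p ! (Suc i mod n)}" for i
  obtain j where j: "j < n" "v = p ! j"
    using v by (auto simp: in_set_conv_nth n_def)
  define j' where "j' = (if j = 0 then n - 1 else j - 1)"
  have n3: "n \<ge> 3" using p by (simp add: n_def)
  have suc: "Suc i mod n = (if i = n - 1 then 0 else Suc i)" if "i < n" for i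
    using that by auto
  have nth: "p ! i = p ! k \<longleftrightarrow> i = k" if "i < n" "k < n" for i k
    using that p by (simp add: nth_eq_iff_index_eq n_def)
  have j': "j' < n" "Suc j' mod n = j" "j \<noteq> j'" "Suc j mod n \<noteq> j'"
    using j n3 by (auto simp: j'_def suc)
  have mem: "v \<in> f i \<longleftrightarrow> i = j \<or> i = j'" if "i < n" for i
  proof -
    have "v \<in> f i \<longleftrightarrow> j = i \<or> j = Suc i mod n"
      using that j nth[of j i] nth[of j "Suc i mod n"] by (auto simp: f_def)
    also have "j = Suc i mod n \<longleftrightarrow> i = j'"
      using that j by (auto simp: j'_def suc)
    finally show ?thesis by auto
  qed
  have "{e \<in> cycle_edges p. v \<in> e} = f ` {i. i < n \<and> v \<in> f i}"
    by (auto simp: cycle_edges_def f_def n_def)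
  also have "{i. i < n \<and> v \<in> f i} = {j, j'}"
    using mem j j' by auto
  finally have "{e \<in> cycle_edges p. v \<in> e} = {f j, f j'}" by simp
  moreover have "f j \<noteq> f j'"
  proof -
    have "p ! (Suc j mod n) \<notin> f j'"
      using j j' n3 nth[of "Suc j mod n" j'] nth[of "Suc j mod n" j]
      by (auto simp: f_def suc split: if_splits)
    then show ?thesis by (auto simp: f_def)
  qed
  ultimately show ?thesis by (simp add: edge_degree_def)
qed

section \<open>Balls of radius \<open>k\<close> and the number of short cycles through a
  vertex\<close>

primrec reach :: "'a set set \<Rightarrow> 'a \<Rightarrow> nat \<Rightarrow> 'a set" where
  "reach E v 0 = {v}"
| "reach E v (Suc k) = (\<Union>u\<in>reach E v k. insert u (\<Union> {e \<in> E. u \<in> e}))"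

lemma reach_mono: "k \<le> l \<Longrightarrow> reach E v k \<subseteq> reach E v l"
  by (rule lift_Suc_mono_le[of "reach E v"]) auto

lemma card_reach_le:
  assumes G: "regular_graph d V E" and v: "v \<in> V"
  shows "reach E v k \<subseteq> V \<and> card (reach E v k) \<le> (2 * d + 1) ^ k"
proof (induction k)
  case 0
  then show ?case using v by simp
next
  case (Suc k)
  have V: "finite V" and e2: "\<And>e. e \<in> E \<Longrightarrow> e \<subseteq> V \<and> card e = 2"
    and deg: "\<And>v. v \<in> V \<Longrightarrow> card {e \<in> E. v \<in> e} = d"
    and E: "finite E"
    using G fin_graph_finite_edges by (auto simp: regular_graph_def fin_graph_def)
  \<comment> \<open>A crude count: both ends of each of the \<open>d\<close> edges at
    \<open>u\<close>, and \<open>u\<close> once more.\<close>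
  have step: "card (insert u (\<Union> {e \<in> E. u \<in> e})) \<le> 2 * d + 1" if "u \<in> V" for u
  proof -
    have "card (\<Union> {e \<in> E. u \<in> e}) \<le> (\<Sum>e | e \<in> E \<and> u \<in> e. card e)"
      by (rule card_Union_le_sum_card)
    also have "\<dots> = (\<Sum>e | e \<in> E \<and> u \<in> e. 2)"
      using e2 by (intro sum.cong) auto
    finally have "card (\<Union> {e \<in> E. u \<in> e}) \<le> 2 * d" using deg[OF that] by simp
    then show ?thesis using card_insert_le_m1[of "2 * d + 1"] by simp
  qed
  have "card (reach E v (Suc k)) \<le> (\<Sum>u\<in>reach E v k. card (insert u (\<Union> {e \<in> E. u \<in> e})))"
    unfolding reach.simps by (rule card_UN_le) (use Suc V finite_subset in blast)
  also have "\<dots> \<le> card (reach E v k) * (2 * d + 1)"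
    using step Suc sum_bounded_above[of "reach E v k" "\<lambda>u. card (insert u (\<Union> {e \<in> E. u \<in> e}))" "2 * d + 1"]
    by auto
  also have "\<dots> \<le> (2 * d + 1) ^ k * (2 * d + 1)"
    using Suc by (intro mult_le_mono1) simp
  finally have "card (reach E v (Suc k)) \<le> (2 * d + 1) ^ Suc k"
    by (simp only: power_Suc mult.commute)
  moreover have "reach E v (Suc k) \<subseteq> V"
    using Suc e2 by auto
  ultimately show ?case by blast
qed

lemma cycle_subset_reach:
  assumes "cycle_edges p \<subseteq> E" "v \<in> set p" "length p \<le> g"
  shows "set p \<subseteq> reach E v g"
proof
  define n where "n = length p"
  obtain j where j: "j < n" "v = p ! j"
    using assms by (auto simp: in_set_conv_nth n_def)
  have walk: "p ! ((j + i) mod n) \<in> reach E v i" for i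
  proof (induction i)
    case 0
    then show ?case using j by simp
  next
    case (Suc i)
    have "0 < n" using j by linarith
    then have "(j + i) mod n < length p" unfolding n_def by (rule mod_less_divisor)
    then have "{p ! ((j + i) mod n), p ! (Suc ((j + i) mod n) mod n)} \<in> E"
      using assms(1) by (auto simp: cycle_edges_def n_def)
    then show ?case
      using Suc by (auto simp: mod_Suc_eq)
  qed
  fix x assume "x \<in> set p"
  then obtain l where l: "l < n" "x = p ! l"
    by (auto simp: in_set_conv_nth n_def)
  \<comment> \<open>The number of steps around the cycle from position \<open>j\<close> to position
    \<open>l\<close>; adding \<open>n\<close> first keeps the subtraction from truncating.\<close>
  define i where "i = (l + n - j) mod n"
  have "(j + i) mod n = (j + (l + n - j)) mod n"
    by (simp add: i_def mod_add_right_eq)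
  also have "\<dots> = l" using l j by simp
  finally have "x \<in> reach E v i" using walk[of i] l by simp
  moreover have "i < n" unfolding i_def using l by (intro mod_less_divisor) linarith
  then have "i \<le> g" using assms(3) by (simp add: n_def)
  ultimately show "x \<in> reach E v g" using reach_mono[of i g E v] by blast
qed

lemma short_cycles_cases:
  assumes "C \<in> short_cycles g E"
  obtains p where "C = cycle_edges p" "\<Union> C = set p" "distinct p" "3 \<le> length p" "length p \<le> g"
    "cycle_edges p \<subseteq> E"
proof -
  from assms obtain p where p: "C = cycle_edges p" "distinct p" "3 \<le> length p" "length p \<le> g"
    "cycle_edges p \<subseteq> E"
    by (auto simp: short_cycles_def)
  moreover have "p \<noteq> []" using p by auto
  ultimately show ?thesis using that Union_cycle_edges by blast
qed

text \<open>Such a cycle is a set of subsets of the ball of radius \<open>g\<close> around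
  \<open>v\<close>, whose size is bounded in terms of \<open>d\<close> and \<open>g\<close>
  alone.\<close>

lemma card_short_cycles_through_vertex:
  assumes G: "regular_graph d V E" and v: "v \<in> V"
  shows "card {C \<in> short_cycles g E. v \<in> \<Union> C} \<le> 2 ^ (2 ^ ((2 * d + 1) ^ g))"
proof -
  have R: "reach E v g \<subseteq> V" "card (reach E v g) \<le> (2 * d + 1) ^ g"
    using card_reach_le[OF G v] by auto
  have "finite V" using G by (auto simp: regular_graph_def fin_graph_def)
  then have fin: "finite (reach E v g)" using R finite_subset by blast
  have "{C \<in> short_cycles g E. v \<in> \<Union> C} \<subseteq> Pow (Pow (reach E v g))"
  proof clarify
    fix C e0 e x assume C: "C \<in> short_cycles g E" and "e0 \<in> C" "v \<in> e0" "e \<in> C" "x \<in> e"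
    obtain p where p: "\<Union> C = set p" "length p \<le> g" "cycle_edges p \<subseteq> E"
      using short_cycles_cases[OF C] by metis
    then have "v \<in> set p" "x \<in> set p" using \<open>e0 \<in> C\<close> \<open>v \<in> e0\<close> \<open>e \<in> C\<close> \<open>x \<in> e\<close> by auto
    then show "x \<in> reach E v g" using cycle_subset_reach[OF p(3) _ p(2)] by blast
  qed
  then have "card {C \<in> short_cycles g E. v \<in> \<Union> C} \<le> 2 ^ (2 ^ card (reach E v g))"
    using card_mono[of "Pow (Pow (reach E v g))"] fin by (simp add: card_Pow)
  also have "\<dots> \<le> 2 ^ (2 ^ ((2 * d + 1) ^ g))"
    using R by (intro power_increasing) auto
  finally show ?thesis .
qed

lemma finite_short_cycles: "finite E \<Longrightarrow> finite (short_cycles g E)"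
  by (rule finite_subset[of _ "Pow E"]) (auto simp: short_cycles_def)

abbreviation vertex_disjoint :: "'a set set set \<Rightarrow> bool" where
  "vertex_disjoint \<equiv> pairwise (\<lambda>C D. \<Union> C \<inter> \<Union> D = {})"

text \<open>Take \<open>F\<close> maximal. By maximality every short cycle meets the vertex set
  \<open>W\<close> of \<open>F\<close>, which has at most \<open>g * card F\<close> elements, and
  each vertex of \<open>W\<close> lies on boundedly many short cycles.\<close>

lemma obtain_disjoint_short_cycles:
  assumes G: "regular_graph d V E"
  obtains F where "F \<subseteq> short_cycles g E" "vertex_disjoint F"
    "card (short_cycles g E) \<le> g * card F * 2 ^ (2 ^ ((2 * d + 1) ^ g))"
proof -
  have V: "finite V" and e2: "\<And>e. e \<in> E \<Longrightarrow> e \<subseteq> V" and E: "finite E"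
    using G fin_graph_finite_edges by (auto simp: regular_graph_def fin_graph_def)
  let ?C = "short_cycles g E" and ?K = "2 ^ (2 ^ ((2 * d + 1) ^ g)) :: nat"
  let ?D = "{F. F \<subseteq> ?C \<and> vertex_disjoint F}"
  have "finite ?D" using finite_short_cycles[OF E, of g] by simp
  moreover have "{} \<in> ?D" by simp
  then have "?D \<noteq> {}" by fast
  ultimately have "\<exists>F\<in>?D. \<forall>F'\<in>?D. F \<subseteq> F' \<longrightarrow> F = F'"
    by (rule finite_has_maximal)
  then obtain F where F: "F \<in> ?D" and max: "\<And>F'. F' \<in> ?D \<Longrightarrow> F \<subseteq> F' \<Longrightarrow> F = F'"
    by (elim bexE) simp
  have finF: "finite F" using F finite_short_cycles[OF E] finite_subset by auto
  define W where "W = (\<Union>C\<in>F. \<Union> C)"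
  have nonempty: "\<Union> C \<noteq> {}" if C: "C \<in> ?C" for C
  proof -
    obtain p where "\<Union> C = set p" "3 \<le> length p"
      using C by (rule short_cycles_cases)
    then show ?thesis by auto
  qed
  have hit: "\<Union> C \<inter> W \<noteq> {}" if C: "C \<in> ?C" for C
  proof
    assume *: "\<Union> C \<inter> W = {}"
    then have "\<Union> C \<inter> \<Union> D = {} \<and> \<Union> D \<inter> \<Union> C = {}" if "D \<in> F" for D
      using that by (auto simp: W_def)
    then have "vertex_disjoint (insert C F)"
      unfolding pairwise_insert using F by blast
    then have "insert C F \<in> ?D" using F C by simp
    then have "C \<in> F" using max[of "insert C F"] by auto
    then show False using * nonempty[OF C] by (auto simp: W_def)
  qed
  have "card (\<Union> C) \<le> g \<and> \<Union> C \<subseteq> V" if C: "C \<in> ?C" for C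
  proof -
    obtain p where "C = cycle_edges p" "\<Union> C = set p" "length p \<le> g" "cycle_edges p \<subseteq> E"
      using C by (rule short_cycles_cases)
    then show ?thesis using card_length[of p] e2 by auto
  qed
  then have gW: "card (\<Union> C) \<le> g \<and> \<Union> C \<subseteq> V" if "C \<in> F" for C
    using F that by auto
  then have "W \<subseteq> V" by (auto simp: W_def)
  then have finW: "finite W" using V finite_subset by auto
  have "card W \<le> (\<Sum>C\<in>F. card (\<Union> C))"
    unfolding W_def using finF by (rule card_UN_le)
  also have "\<dots> \<le> (\<Sum>C\<in>F. g)"
    using gW by (intro sum_mono) auto
  finally have cW: "card W \<le> g * card F" by (simp add: mult.commute)
  have "?C \<subseteq> (\<Union>v\<in>W. {C \<in> ?C. v \<in> \<Union> C})"
    using hit by blast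
  then have "card ?C \<le> card (\<Union>v\<in>W. {C \<in> ?C. v \<in> \<Union> C})"
    using finW finite_short_cycles[OF E] by (intro card_mono) auto
  also have "\<dots> \<le> (\<Sum>v\<in>W. card {C \<in> ?C. v \<in> \<Union> C})"
    using finW by (rule card_UN_le)
  also have "\<dots> \<le> (\<Sum>v\<in>W. ?K)"
    using \<open>W \<subseteq> V\<close> by (intro sum_mono card_short_cycles_through_vertex[OF G]) auto
  also have "\<dots> = card W * ?K"
    by (simp only: sum_constant of_nat_id)
  also have "\<dots> \<le> g * card F * ?K"
    using cW by (rule mult_le_mono1)
  finally show ?thesis using F by (intro that) simp_all
qed

text \<open>By disjointness the union of \<open>S\<close> has degree 2 at the vertices of its cycles
  and degree 0 elsewhere. A factor \<open>m\<close> is thus lost at no more than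
  \<open>g * card S\<close> vertices, and \<open>m \<le> 1\<close> allows exactly that many to be
  charged.\<close>

lemma prod_disjoint_cycles_ge:
  fixes s :: "nat \<Rightarrow> real"
  assumes V: "finite V" and S: "S \<subseteq> short_cycles g E" "vertex_disjoint S" "finite S"
    and s: "s 0 > 0" "0 < m" "m \<le> 1" "m * s 0 \<le> s 2"
  shows "s 0 ^ card V * (m ^ g) ^ card S \<le> (\<Prod>v\<in>V. s (edge_degree (\<Union> S) v))"
proof -
  define W where "W = (\<Union>C\<in>S. \<Union> C)"
  have cyc: "card (\<Union> C) \<le> g \<and> finite (\<Union> C) \<and> (\<forall>v\<in>\<Union> C. edge_degree C v = 2)" if "C \<in> S" for C
  proof -
    have "C \<in> short_cycles g E" using S(1) that by blast
    then obtain p where p: "C = cycle_edges p" "\<Union> C = set p" "distinct p" "3 \<le> length p" "length p \<le> g"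
      by (rule short_cycles_cases)
    then show ?thesis
      using card_length[of p] edge_degree_cycle_edges[OF p(3,4)] by auto
  qed
  have in_W: "edge_degree (\<Union> S) v = 2" if "v \<in> W" for v
  proof -
    obtain C where C: "C \<in> S" "v \<in> \<Union> C" using \<open>v \<in> W\<close> by (auto simp: W_def)
    have "{e \<in> \<Union> S. v \<in> e} = {e \<in> C. v \<in> e}"
    proof
      show "{e \<in> \<Union> S. v \<in> e} \<subseteq> {e \<in> C. v \<in> e}"
      proof clarify
        fix e D assume "D \<in> S" "e \<in> D" "v \<in> e"
        then have "\<not> \<Union> C \<inter> \<Union> D = {}" using C by blast
        then have "C = D" using S(2) C \<open>D \<in> S\<close> by (auto simp: pairwise_def)
        then show "e \<in> C" using \<open>e \<in> D\<close> by simp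
      qed
    qed (use C in auto)
    then have "edge_degree (\<Union> S) v = edge_degree C v" unfolding edge_degree_def by (rule arg_cong)
    then show ?thesis using cyc[OF C(1)] C(2) by metis
  qed
  have out_W: "edge_degree (\<Union> S) v = 0" if "v \<notin> W" for v
  proof -
    have "{e \<in> \<Union> S. v \<in> e} = {}" using that by (auto simp: W_def)
    then show ?thesis unfolding edge_degree_def by (simp only: card.empty)
  qed
  have "finite W" unfolding W_def using S cyc by blast
  have "card (V \<inter> W) \<le> card W"
    using \<open>finite W\<close> by (simp add: card_mono)
  also have "\<dots> \<le> (\<Sum>C\<in>S. card (\<Union> C))"
    unfolding W_def using S(3) by (rule card_UN_le)
  also have "\<dots> \<le> (\<Sum>C\<in>S. g)"
    using cyc by (intro sum_mono) auto
  finally have "card (V \<inter> W) \<le> g * card S"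
    by (simp add: mult.commute)
  then have "(m ^ g) ^ card S \<le> m ^ card (V \<inter> W)"
    using s by (simp add: power_decreasing flip: power_mult)
  then have "s 0 ^ card V * (m ^ g) ^ card S \<le> s 0 ^ card V * m ^ card (V \<inter> W)"
    using s by simp
  also have "\<dots> = (\<Prod>v\<in>V. s 0 * (if v \<in> W then m else 1))"
    using V by (simp add: prod.distrib prod.If_cases)
  also have "\<dots> \<le> (\<Prod>v\<in>V. s (edge_degree (\<Union> S) v))"
    using s by (intro prod_mono) (auto simp: in_W out_W mult.commute)
  finally show ?thesis .
qed

text \<open>Keep only the edge sets that are unions of subfamilies of \<open>F\<close>; all other
  terms are nonnegative. Their lower bounds add up by the binomial theorem.\<close>

lemma sum_disjoint_cycles_ge:
  fixes s :: "nat \<Rightarrow> real"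
  assumes G: "regular_graph d V E" and F: "F \<subseteq> short_cycles g E" "vertex_disjoint F"
    and s: "s 0 > 0" "0 < m" "m \<le> 1" "m * s 0 \<le> s 2" and nonneg: "\<And>k. k \<le> d \<Longrightarrow> s k \<ge> 0"
  shows "s 0 ^ card V * (1 + m ^ g) ^ card F \<le> (\<Sum>A\<in>Pow E. \<Prod>v\<in>V. s (edge_degree A v))"
proof -
  have V: "finite V" and E: "finite E" and deg: "\<And>v. v \<in> V \<Longrightarrow> card {e \<in> E. v \<in> e} = d"
    using G fin_graph_finite_edges by (auto simp: regular_graph_def fin_graph_def)
  have finF: "finite F" using F finite_short_cycles[OF E] finite_subset by auto
  have FE: "C \<subseteq> E" "C \<noteq> {}" "{} \<notin> C" if "C \<in> F" for C
  proof -
    have "C \<in> short_cycles g E" using F(1) that by blast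
    then obtain p where p: "C = cycle_edges p" "3 \<le> length p" "cycle_edges p \<subseteq> E"
      by (rule short_cycles_cases)
    then have "{p ! 0, p ! (Suc 0 mod length p)} \<in> C" by (auto simp: cycle_edges_def)
    then show "C \<subseteq> E" "C \<noteq> {}" "{} \<notin> C" using p by (auto simp: cycle_edges_def)
  qed
  have inj: "inj_on Union (Pow F)"
  proof (rule inj_on_inverseI)
    fix S assume S: "S \<in> Pow F"
    \<comment> \<open>A subfamily is recovered from its union as the members of \<open>F\<close>
      contained in it, so distinct subfamilies give distinct edge sets.\<close>
    show "{C \<in> F. C \<subseteq> \<Union> S} = S"
    proof (intro equalityI subsetI)
      fix C assume "C \<in> {C \<in> F. C \<subseteq> \<Union> S}"
      then have C: "C \<in> F" "C \<subseteq> \<Union> S" by auto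
      obtain e where e: "e \<in> C" "e \<noteq> {}" using FE[OF C(1)] by blast
      then obtain D where D: "D \<in> S" "e \<in> D" using C by auto
      have "\<not> \<Union> C \<inter> \<Union> D = {}" using e D by blast
      then have "C = D" using F(2) C D S by (auto simp: pairwise_def)
      then show "C \<in> S" using D by simp
    qed (use S in auto)
  qed
  have sub: "S \<subseteq> F \<Longrightarrow> S \<subseteq> short_cycles g E \<and> vertex_disjoint S \<and> finite S" for S
    using F finF by (auto intro: pairwise_subset finite_subset)
  have "s 0 ^ card V * (1 + m ^ g) ^ card F = (\<Sum>S\<in>Pow F. s 0 ^ card V * (m ^ g) ^ card S)"
    using sum_Pow_power_card[OF finF, of "m ^ g"] by (simp flip: sum_distrib_left)
  also have "\<dots> \<le> (\<Sum>S\<in>Pow F. \<Prod>v\<in>V. s (edge_degree (\<Union> S) v))"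
    using sub by (intro sum_mono prod_disjoint_cycles_ge[OF V _ _ _ s, of _ g E]) auto
  also have "\<dots> = (\<Sum>A\<in>Union ` Pow F. \<Prod>v\<in>V. s (edge_degree A v))"
    by (simp add: sum.reindex[OF inj])
  also have "\<dots> \<le> (\<Sum>A\<in>Pow E. \<Prod>v\<in>V. s (edge_degree A v))"
  proof (rule sum_mono2)
    show "Union ` Pow F \<subseteq> Pow E" using FE by blast
    fix A assume "A \<in> Pow E - Union ` Pow F"
    then have "edge_degree A v \<le> d" if "v \<in> V" for v
      using that E deg[OF that] card_mono[of "{e \<in> E. v \<in> e}" "{e \<in> A. v \<in> e}"]
      by (auto simp: edge_degree_def)
    then show "0 \<le> (\<Prod>v\<in>V. s (edge_degree A v))"
      by (intro prod_nonneg ballI nonneg)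
  qed (use E in simp)
  finally show ?thesis .
qed

section \<open>Assembling the lower bound and the exponential gain\<close>

theorem mainTheorem2:
  fixes d :: nat and q w :: real
  assumes "d \<ge> 1" and "q \<ge> 2" and "w \<ge> 0"
  shows "(\<forall>(V :: 'a set) E. regular_graph d V E \<longrightarrow> cluster_Z V E q w \<ge> Phi d q w ^ card V) \<and>
    (w > 0 \<longrightarrow>
      (\<forall>\<epsilon>>0. \<forall>g\<ge>1. \<exists>\<delta>>0. \<forall>(V :: 'a set) E.
        regular_graph d V E \<longrightarrow>
        real (card (short_cycles g E)) \<ge> \<epsilon> * real (card V) \<longrightarrow>
        cluster_Z V E q w \<ge> ((1 + \<delta>) * Phi d q w) ^ card V))"
proof -
  obtain a1 a2 b1 b2 where
    m: "a1\<^sup>2 + b1\<^sup>2 = 1 + w" "a1 * a2 + b1 * b2 = 1" "a2\<^sup>2 + b2\<^sup>2 = 1 + w / (q - 1)" and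
    c0: "spin_coeff d q a1 a2 b1 b2 0 = Phi d q w" and
    cn: "\<forall>k\<le>d. spin_coeff d q a1 a2 b1 b2 k \<ge> 0" and
    c2: "w > 0 \<longrightarrow> spin_coeff d q a1 a2 b1 b2 2 > 0"
    by (rule nonneg_decomposition[OF assms]) (rule that)
  define s where "s = spin_coeff d q a1 a2 b1 b2"
  have Z: "(\<Sum>A\<in>Pow E. \<Prod>v\<in>V. s (edge_degree A v)) \<le> cluster_Z V E q w"
    if "regular_graph d V E" for V :: "'a set" and E
    unfolding s_def by (rule cluster_Z_ge_sum_spin_coeff[OF that assms(2,3) m])
  have s0: "s 0 = Phi d q w" "s 0 > 0" and sn: "\<And>k. k \<le> d \<Longrightarrow> s k \<ge> 0"
    using c0 cn Phi_pos[OF assms(2,3)] by (auto simp: s_def)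
  have "cluster_Z V E q w \<ge> Phi d q w ^ card V" if G: "regular_graph d V E" for V :: "'a set" and E
  proof -
    have fin: "finite V" "finite E"
      using G fin_graph_finite_edges by (auto simp: regular_graph_def fin_graph_def)
    have deg: "edge_degree A v \<le> d" if "A \<subseteq> E" "v \<in> V" for A v
      using that G fin card_mono[of "{e \<in> E. v \<in> e}" "{e \<in> A. v \<in> e}"]
      by (auto simp: edge_degree_def regular_graph_def)
    \<comment> \<open>This is the term \<open>A = {}\<close>, where every vertex has degree
      0.\<close>
    have "Phi d q w ^ card V = (\<Prod>v\<in>V. s (edge_degree {} v))"
      by (simp add: edge_degree_def s0(1))
    also have "\<dots> \<le> (\<Sum>A\<in>Pow E. \<Prod>v\<in>V. s (edge_degree A v))"
      using fin deg by (intro member_le_sum[of "{}"] prod_nonneg ballI sn) auto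
    also have "\<dots> \<le> cluster_Z V E q w" by (rule Z[OF G])
    finally show ?thesis .
  qed
  moreover have "\<exists>\<delta>>0. \<forall>(V :: 'a set) E. regular_graph d V E \<longrightarrow>
        real (card (short_cycles g E)) \<ge> \<epsilon> * real (card V) \<longrightarrow>
        cluster_Z V E q w \<ge> ((1 + \<delta>) * Phi d q w) ^ card V"
    if "w > 0" "\<epsilon> > 0" "g \<ge> 1" for \<epsilon> :: real and g :: nat
  proof -
    define m where "m = min 1 (s 2 / s 0)"
    \<comment> \<open>An upper bound for the number of short cycles per member of the disjoint
      family.\<close>
    define K :: nat where "K = g * 2 ^ (2 ^ ((2 * d + 1) ^ g))"
    have m: "0 < m" "m \<le> 1" "m * s 0 \<le> s 2"
      using c2 \<open>w > 0\<close> s0 by (auto simp: m_def s_def min_def field_simps)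
    have "K > 0" using \<open>g \<ge> 1\<close> by (simp add: K_def)
    define \<rho> where "\<rho> = 1 + m ^ g"
    have "\<rho> > 1" using m by (simp add: \<rho>_def)
    \<comment> \<open>Chosen so that \<open>(1 + \<delta>) ^ card V\<close> equals \<rho> to the
      power \<open>\<epsilon> * card V / K\<close>, an exponent that is at most
      \<open>card F\<close>. It does not depend on the graph.\<close>
    define \<delta> where "\<delta> = \<rho> powr (\<epsilon> / K) - 1"
    have "\<delta> > 0" using \<open>\<rho> > 1\<close> \<open>\<epsilon> > 0\<close> \<open>K > 0\<close> by (simp add: \<delta>_def)
    moreover have "((1 + \<delta>) * Phi d q w) ^ card V \<le> cluster_Z V E q w"
      if G: "regular_graph d V E" and many: "\<epsilon> * real (card V) \<le> real (card (short_cycles g E))"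
      for V :: "'a set" and E
    proof -
      obtain F where F: "F \<subseteq> short_cycles g E" "vertex_disjoint F"
        "card (short_cycles g E) \<le> g * card F * 2 ^ (2 ^ ((2 * d + 1) ^ g))"
        using obtain_disjoint_short_cycles[OF G] by blast
      have "card (short_cycles g E) \<le> card F * K"
        using F(3) by (simp add: K_def mult.commute mult.left_commute)
      then have "real (card (short_cycles g E)) \<le> real (card F) * real K"
        by (metis of_nat_le_iff of_nat_mult)
      then have "\<epsilon> / K * card V \<le> card F"
        using many \<open>K > 0\<close> by (simp add: field_simps)
      then have "\<rho> powr (\<epsilon> / K * card V) \<le> \<rho> powr card F"
        using \<open>\<rho> > 1\<close> by (intro powr_mono) auto
      also have "\<rho> powr (\<epsilon> / K * card V) = (\<rho> powr (\<epsilon> / K)) ^ card V"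
        using \<open>\<rho> > 1\<close> by (simp only: powr_realpow powr_powr[symmetric] powr_gt_zero)
      also have "\<rho> powr card F = \<rho> ^ card F"
        using \<open>\<rho> > 1\<close> by (simp add: powr_realpow)
      finally have "(1 + \<delta>) ^ card V \<le> \<rho> ^ card F"
        by (simp add: \<delta>_def)
      from mult_left_mono[OF this, of "s 0 ^ card V"] s0(2)
      have "((1 + \<delta>) * Phi d q w) ^ card V \<le> s 0 ^ card V * \<rho> ^ card F"
        unfolding s0(1)[symmetric] power_mult_distrib by (simp only: mult.commute zero_le_power less_imp_le)
      also have "\<dots> \<le> (\<Sum>A\<in>Pow E. \<Prod>v\<in>V. s (edge_degree A v))"
        unfolding \<rho>_def by (rule sum_disjoint_cycles_ge[OF G F(1,2) s0(2) m sn])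
      also have "\<dots> \<le> cluster_Z V E q w" by (rule Z[OF G])
      finally show ?thesis .
    qed
    ultimately show ?thesis by blast
  qed
  ultimately show ?thesis by blast
qed

end
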